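(* Let $\mathfrak{B}$ be a Boolean weak contact algebra. Then the relation $\trianglelefteq$ (where $X\trianglelefteq Y$ iff for every $y\in Y$ there is $x\in X$ with $x\leq y$) restricted to the set of all G-representatives of $\mathfrak{B}$ is an equivalence relation.
   Context: A Boolean weak contact algebra is a Boolean algebra $\langle B,\cdot,+,-,\mathsf{0},\mathsf{1}\rangle$ with a binary relation $\mathsf{C}$ satisfying: (C0) $\neg(\mathsf{0}\mathrel{\mathsf{C}} x)$; (C1) $x\leq y\wedge x\neq \mathsf{0}\to x\mathrel{\mathsf{C}} y$; (C2) $x\mathrel{\mathsf{C}} y\to y\mathrel{\mathsf{C}} x$; (C3) $x\leq y\to \forall z\,(z\mathrel{\mathsf{C}} x\to z\mathrel{\mathsf{C}} y)$. Write $x\ll y$ iff $\neg(x\mathrel{\mathsf{C}} -y)$, and $x \mathrel{\mathsf{O}} y$ iff $x\cdot y\neq\mathsf{0}$. A G-representative is a non-empty set $Q\subseteq B$ such that (r0) $\mathsf{0}\notin Q$; (r1) for all $u,v\in Q$: $u=v$ or $u\ll v$ or $v\ll u$; (r2) for every $u\in Q$ there is $v\in Q$ with $v\ll u$; (r3) for all $x,y\in B$: if $u\mathrel{\mathsf{O}} x$ and $u\mathrel{\mathsf{O}} y$ for every $u\in Q$, then $x\mathrel{\mathsf{C}} y$. *)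

theory Defs
  imports Main
begin

locale boolean_weak_contact_algebra =
  fixes C :: "'a::boolean_algebra \<Rightarrow> 'a \<Rightarrow> bool"
  assumes C0: "\<not> C bot x"
    and C1: "x \<le> y \<and> x \<noteq> bot \<longrightarrow> C x y"
    and C2: "C x y \<longrightarrow> C y x"
    and C3: "x \<le> y \<longrightarrow> (\<forall>z. C z x \<longrightarrow> C z y)"

definition non_tangential_part :: "('a::boolean_algebra \<Rightarrow> 'a \<Rightarrow> bool) \<Rightarrow> 'a \<Rightarrow> 'a \<Rightarrow> bool" where
  "non_tangential_part C x y \<longleftrightarrow> \<not> C x (- y)"

definition overlap :: "'a::boolean_algebra \<Rightarrow> 'a \<Rightarrow> bool" where
  "overlap x y \<longleftrightarrow> inf x y \<noteq> bot"

definition G_representative :: "('a::boolean_algebra \<Rightarrow> 'a \<Rightarrow> bool) \<Rightarrow> 'a set \<Rightarrow> bool" where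
  "G_representative C Q \<longleftrightarrow>
     Q \<noteq> {} \<and>
     bot \<notin> Q \<and>
     (\<forall>u\<in>Q. \<forall>v\<in>Q. u = v \<or> non_tangential_part C u v \<or> non_tangential_part C v u) \<and>
     (\<forall>u\<in>Q. \<exists>v\<in>Q. non_tangential_part C v u) \<and>
     (\<forall>x y. (\<forall>u\<in>Q. overlap u x \<and> overlap u y) \<longrightarrow> C x y)"

definition trianglelefteq :: "'a::order set \<Rightarrow> 'a set \<Rightarrow> bool"  (infix "\<unlhd>" 50) where
  "X \<unlhd> Y \<longleftrightarrow> (\<forall>y\<in>Y. \<exists>x\<in>X. x \<le> y)"

end

theory Submission
  imports Defs
begin

text \<open>Reflexivity and transitivity come from those of \<open>\<le>\<close>; the content is
  symmetry. Suppose \<open>X \<unlhd> Y\<close>, but no member of \<open>Y\<close> lies below some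
  \<open>x\<close> in \<open>X\<close>. Pick \<open>v\<close> in \<open>X\<close> well inside
  \<open>x\<close>. Each \<open>y\<close> in \<open>Y\<close> meets \<open>- x\<close>, and it meets
  \<open>v\<close> because it lies above a member of \<open>X\<close> and members of
  \<open>X\<close> overlap pairwise (\<open>G_representative_overlap\<close>). So \<open>v\<close>
  is in contact with \<open>- x\<close>, a contradiction.\<close>

context boolean_weak_contact_algebra
begin

text \<open>A nonzero \<open>inf u (- v)\<close> would touch \<open>u\<close>, and by symmetry and
  monotonicity of contact \<open>u\<close> would touch \<open>- v\<close>.\<close>

lemma non_tangential_part_imp_le:
  assumes "non_tangential_part C u v"
  shows "u \<le> v"
proof (rule ccontr)
  assume "\<not> u \<le> v"
  then have "inf u (- v) \<noteq> bot"
    by (metis inf_shunt double_compl)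
  then have "C (inf u (- v)) u"
    using C1 inf_le1 by blast
  then have "C u (inf u (- v))"
    using C2 by blast
  then have "C u (- v)"
    using C3 inf_le2 by blast
  then show False
    using assms by (simp add: non_tangential_part_def)
qed

text \<open>\<open>Q\<close> is a chain of nonzero elements, so the meet of two members is the
  smaller one.\<close>

lemma G_representative_overlap:
  assumes "G_representative C Q" "u \<in> Q" "v \<in> Q"
  shows "overlap u v"
proof -
  have "u \<le> v \<or> v \<le> u"
    using assms unfolding G_representative_def by (metis non_tangential_part_imp_le order_refl)
  moreover have "u \<noteq> bot" "v \<noteq> bot"
    using assms unfolding G_representative_def by auto
  ultimately show ?thesis
    by (auto simp: overlap_def inf_absorb1 inf_absorb2)
qed

lemma G_representative_trianglelefteq_sym:
  assumes X: "G_representative C X" and Y: "G_representative C Y" and "X \<unlhd> Y"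
  shows "Y \<unlhd> X"
  unfolding trianglelefteq_def
proof (intro ballI, rule ccontr)
  fix x assume "x \<in> X" and none: "\<not> (\<exists>y\<in>Y. y \<le> x)"
  then obtain v where "v \<in> X" and v: "non_tangential_part C v x"
    using X unfolding G_representative_def by blast
  \<comment> \<open>Every member of \<open>Y\<close> overlaps both \<open>v\<close> and \<open>- x\<close>, so (r3) for \<open>Y\<close> contradicts \<open>v \<lless> x\<close>.\<close>
  have "overlap y v \<and> overlap y (- x)" if "y \<in> Y" for y
  proof
    obtain z where "z \<in> X" "z \<le> y"
      using \<open>X \<unlhd> Y\<close> \<open>y \<in> Y\<close> unfolding trianglelefteq_def by blast
    then have "inf z v \<noteq> bot" "inf z v \<le> inf y v"
      using G_representative_overlap[OF X _ \<open>v \<in> X\<close>] by (simp_all add: overlap_def le_infI1)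
    then show "overlap y v"
      unfolding overlap_def by (metis bot_unique)
    \<comment> \<open>A zero meet with \<open>- x\<close> would mean
      \<open>y \<le> x\<close>.\<close>
    show "overlap y (- x)"
      using none \<open>y \<in> Y\<close> unfolding overlap_def by (metis inf_shunt double_compl)
  qed
  then have "C v (- x)"
    using Y unfolding G_representative_def by blast
  then show False
    using v by (simp add: non_tangential_part_def)
qed

end

lemma trianglelefteq_refl: "X \<unlhd> X"
  unfolding trianglelefteq_def by blast

lemma trianglelefteq_trans: "X \<unlhd> Y \<Longrightarrow> Y \<unlhd> Z \<Longrightarrow> X \<unlhd> Z"
  unfolding trianglelefteq_def by (meson order_trans)

theorem theorem2p4:
  fixes C :: "'a::boolean_algebra \<Rightarrow> 'a \<Rightarrow> bool"
  assumes "boolean_weak_contact_algebra C"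
  shows "equiv {Q. G_representative C Q}
               {(X, Y). G_representative C X \<and> G_representative C Y \<and> X \<unlhd> Y}"
proof -
  interpret boolean_weak_contact_algebra C by fact
  show ?thesis
    by (rule equivI)
      (auto simp: refl_on_def sym_def trans_def trianglelefteq_refl
        intro: G_representative_trianglelefteq_sym trianglelefteq_trans)
qed

end
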